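(* Suppose that $\alpha$ is a non-negative random variable with continuous distribution function $F$, $F(0)=0$, and finite expectation $\mathbb{E}\alpha<+\infty$, such that $p_1<+\infty$. The seller's revenue function $R(p)=p\,\mathbb{E}(\alpha-p)_+$ is maximized at all points $p^*$ with unitary price elasticity of expected demand, i.e., at all points $p^*$ that satisfy $\ell(p^* )=1$ or equivalently, $p^*=\mathrm{m}(p^* )$. If $\ell(p)$ is strictly decreasing, then a fixed point $p^*$ (i.e., a point with $p^*=\mathrm{m}(p^* )$) exists and is unique.
   Context: Notation: $x_+:=\max\{x,0\}$, $\bar F:=1-F$, $H:=\inf\{p\ge 0: F(p)=1\}\le+\infty$ (with $\inf\emptyset=+\infty$). A seller posts a price $p$ and faces the linear stochastic demand $D(p\mid\alpha)=(\alpha-p)_+$, where $\alpha$ is the random demand level. The mean residual demand (MRD) function of $\alpha$ is $\mathrm{m}(p):=\mathbb{E}(\alpha-p\mid \alpha>p)=\frac{1}{\bar F(p)}\int_p^{+\infty}\bar F(u)\,du$ if $p<H$, and $\mathrm{m}(p):=0$ otherwise. The generalized mean residual demand (GMRD) function is $\ell(p):=\mathrm{m}(p)/p$ for $0<p<H$. The price elasticity of expected demand is $\varepsilon(p):=-p\cdot\frac{d}{dp}\mathbb{E}(\alpha-p)_+\big/\mathbb{E}(\alpha-p)_+$, which equals $1/\ell(p)$ for $0<p<H$. Finally, $p_1:=\sup\{p\ge 0:\ell(p)\ge 1\}$, where $p$ ranges over the points at which $\ell$ is defined.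
   Formalization: Not every point with ℓ(p* )=1 maximizes R in general (α ~ 0.99·U[0.9,1.1]+0.01·U[49,51], p*=0.745). Proved instead: a maximizer exists and every maximizer has unit elasticity; that the fixed point maximizes R is stated when ℓ is strictly decreasing. *)

theory Defs
  imports "HOL-Probability.Probability"
begin

text \<open>
  Throughout, \<open>M\<close> is a probability space and \<open>\<alpha>\<close> a real random variable on it (the demand level).
\<close>

definition distr_fun :: "'a measure \<Rightarrow> ('a \<Rightarrow> real) \<Rightarrow> real \<Rightarrow> real" where
  "distr_fun M \<alpha> = cdf (distr M borel \<alpha>)"

text \<open>In \<^typ>\<open>ereal\<close> the infimum of the empty set is \<open>\<infinity>\<close>.\<close>

definition upper_end :: "'a measure \<Rightarrow> ('a \<Rightarrow> real) \<Rightarrow> ereal" where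
  "upper_end M \<alpha> = (INF p\<in>{p. 0 \<le> p \<and> distr_fun M \<alpha> p = 1}. ereal p)"

definition demand :: "real \<Rightarrow> real \<Rightarrow> real" where
  "demand p a = max (a - p) 0"

definition expected_demand :: "'a measure \<Rightarrow> ('a \<Rightarrow> real) \<Rightarrow> real \<Rightarrow> real" where
  "expected_demand M \<alpha> p = (LINT \<omega>|M. demand p (\<alpha> \<omega>))"

definition revenue :: "'a measure \<Rightarrow> ('a \<Rightarrow> real) \<Rightarrow> real \<Rightarrow> real" where
  "revenue M \<alpha> p = p * expected_demand M \<alpha> p"

text \<open>
  The conditional expectation given the event \<open>\<alpha> > p\<close> is the expectation under the conditional
  probability measure; for \<open>p < H\<close> the event has positive probability.  The tail-integral formula
  is \<open>mrd_eq_tail_integral\<close> below.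
\<close>

definition mrd :: "'a measure \<Rightarrow> ('a \<Rightarrow> real) \<Rightarrow> real \<Rightarrow> real" where
  "mrd M \<alpha> p =
    (if ereal p < upper_end M \<alpha>
     then (LINT \<omega>|uniform_measure M {\<omega> \<in> space M. \<alpha> \<omega> > p}. \<alpha> \<omega> - p)
     else 0)"

text \<open>The points at which the generalized mean residual demand is defined.\<close>

definition gmrd_dom :: "'a measure \<Rightarrow> ('a \<Rightarrow> real) \<Rightarrow> real set" where
  "gmrd_dom M \<alpha> = {p. 0 < p \<and> ereal p < upper_end M \<alpha>}"

definition gmrd :: "'a measure \<Rightarrow> ('a \<Rightarrow> real) \<Rightarrow> real \<Rightarrow> real" where
  "gmrd M \<alpha> p = mrd M \<alpha> p / p"

definition elasticity :: "'a measure \<Rightarrow> ('a \<Rightarrow> real) \<Rightarrow> real \<Rightarrow> real" where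
  "elasticity M \<alpha> p = - p * (deriv (expected_demand M \<alpha>) p / expected_demand M \<alpha> p)"

definition p_one :: "'a measure \<Rightarrow> ('a \<Rightarrow> real) \<Rightarrow> ereal" where
  "p_one M \<alpha> = (SUP p\<in>{p \<in> gmrd_dom M \<alpha>. gmrd M \<alpha> p \<ge> 1}. ereal p)"

lemma mrd_eq_tail_integral:
  assumes "prob_space M" and [measurable]: "\<alpha> \<in> borel_measurable M"
    and "0 \<le> p" and p: "ereal p < upper_end M \<alpha>"
  shows "mrd M \<alpha> p =
    (LBINT u:{p<..}. 1 - distr_fun M \<alpha> u) / (1 - distr_fun M \<alpha> p)"
proof -
  interpret prob_space M by fact
  interpret P: pair_sigma_finite M lborel ..
  let ?A = "{\<omega> \<in> space M. \<alpha> \<omega> > p}"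
  have tail: "1 - distr_fun M \<alpha> u = prob {\<omega> \<in> space M. \<alpha> \<omega> > u}" for u
  proof -
    have "distr_fun M \<alpha> u = prob {\<omega> \<in> space M. \<alpha> \<omega> \<le> u}"
      unfolding distr_fun_def cdf_def
      by (subst measure_distr) (auto intro!: arg_cong[where f="measure M"])
    moreover have "prob {\<omega> \<in> space M. \<not> \<alpha> \<omega> \<le> u} = 1 - prob {\<omega> \<in> space M. \<alpha> \<omega> \<le> u}"
      by (rule prob_neg) measurable
    ultimately show ?thesis by (simp add: not_le)
  qed
  have mono: "prob {\<omega> \<in> space M. \<alpha> \<omega> > v} \<le> prob {\<omega> \<in> space M. \<alpha> \<omega> > u}" if "u \<le> v" for u v
    using that by (intro finite_measure_mono) auto
  have [measurable]: "(\<lambda>u. 1 - distr_fun M \<alpha> u) \<in> borel_measurable borel"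
  proof -
    have "mono (\<lambda>u. - (1 - distr_fun M \<alpha> u))"
      unfolding tail using mono by (auto intro!: monoI)
    from borel_measurable_mono[OF this]
    have "(\<lambda>u. - (- (1 - distr_fun M \<alpha> u))) \<in> borel_measurable borel" by measurable
    then show ?thesis by simp
  qed
  have "(\<integral>\<^sup>+u. ennreal (indicator {p<..} u * (1 - distr_fun M \<alpha> u)) \<partial>lborel)
      = (\<integral>\<^sup>+u. (\<integral>\<^sup>+\<omega>. indicator {p<..<\<alpha> \<omega>} u \<partial>M) \<partial>lborel)"
  proof (rule nn_integral_cong)
    fix u :: real
    have "(\<integral>\<^sup>+\<omega>. indicator {p<..<\<alpha> \<omega>} u \<partial>M)
        = (\<integral>\<^sup>+\<omega>. indicator {p<..} u * indicator {\<omega> \<in> space M. \<alpha> \<omega> > u} \<omega> \<partial>M)"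
      by (intro nn_integral_cong) (auto split: split_indicator)
    also have "\<dots> = indicator {p<..} u * emeasure M {\<omega> \<in> space M. \<alpha> \<omega> > u}"
      by (subst nn_integral_cmult_indicator) auto
    finally show "ennreal (indicator {p<..} u * (1 - distr_fun M \<alpha> u))
        = (\<integral>\<^sup>+\<omega>. indicator {p<..<\<alpha> \<omega>} u \<partial>M)"
      by (simp add: tail emeasure_eq_measure split: split_indicator)
  qed
  also have "\<dots> = (\<integral>\<^sup>+\<omega>. (\<integral>\<^sup>+u. indicator {p<..<\<alpha> \<omega>} u \<partial>lborel) \<partial>M)"
  proof (rule P.Fubini')
    have "Measurable.pred (M \<Otimes>\<^sub>M lborel) (\<lambda>x. p < snd x \<and> snd x < \<alpha> (fst x))"
      by measurable
    then have "(\<lambda>x. if p < snd x \<and> snd x < \<alpha> (fst x) then 1 else 0 :: ennreal)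
        \<in> borel_measurable (M \<Otimes>\<^sub>M lborel)"
      by measurable
    then show "(\<lambda>(x, y). indicator {p<..<\<alpha> x} y :: ennreal) \<in> borel_measurable (M \<Otimes>\<^sub>M lborel)"
      by (rule back_subst[where P="\<lambda>f. f \<in> borel_measurable (M \<Otimes>\<^sub>M lborel)"])
         (auto simp: fun_eq_iff split: split_indicator)
  qed
  also have "\<dots> = (\<integral>\<^sup>+\<omega>. ennreal (max (\<alpha> \<omega> - p) 0) \<partial>M)"
  proof (rule nn_integral_cong)
    fix \<omega>
    show "(\<integral>\<^sup>+u. indicator {p<..<\<alpha> \<omega>} u \<partial>lborel) = ennreal (max (\<alpha> \<omega> - p) 0)"
      by (cases "p \<le> \<alpha> \<omega>") (auto simp: max_def ennreal_neg)
  qed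
  finally have nn: "(\<integral>\<^sup>+u. ennreal (indicator {p<..} u * (1 - distr_fun M \<alpha> u)) \<partial>lborel)
      = (\<integral>\<^sup>+\<omega>. ennreal (max (\<alpha> \<omega> - p) 0) \<partial>M)" .
  have tailint: "(LBINT u:{p<..}. 1 - distr_fun M \<alpha> u) = (LINT \<omega>|M. max (\<alpha> \<omega> - p) 0)"
    unfolding set_lebesgue_integral_def
    by (subst (1 2) integral_eq_nn_integral) (auto simp: tail nn[unfolded tail])
  have "distr_fun M \<alpha> p \<noteq> 1"
  proof
    assume "distr_fun M \<alpha> p = 1"
    then have "upper_end M \<alpha> \<le> ereal p"
      unfolding upper_end_def using \<open>0 \<le> p\<close> by (intro INF_lower) auto
    then show False using p by simp
  qed
  then have pos: "prob ?A > 0"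
    using tail[of p] by (smt (verit) measure_nonneg)
  have "(LINT \<omega>|uniform_measure M ?A. \<alpha> \<omega> - p)
      = (LINT \<omega>|M. (indicator ?A \<omega> / prob ?A) *\<^sub>R (\<alpha> \<omega> - p))"
  proof -
    have "uniform_measure M ?A = density M (\<lambda>\<omega>. ennreal (indicator ?A \<omega> / prob ?A))"
      unfolding uniform_measure_def
      using pos by (intro arg_cong[where f="density M"])
        (auto simp: fun_eq_iff emeasure_eq_measure divide_ennreal simp flip: ennreal_1 split: split_indicator)
    then show ?thesis
      using pos by (simp only:) (subst integral_density, auto)
  qed
  also have "\<dots> = (LINT \<omega>|M. max (\<alpha> \<omega> - p) 0 / prob ?A)"
    by (intro Bochner_Integration.integral_cong) (auto split: split_indicator)
  finally show ?thesis
    using p tailint by (simp add: mrd_def tail)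
qed

end

theory Submission
  imports Defs
begin

text \<open>
  Write \<open>T\<close> for the survival function of the demand level and \<open>E p\<close> for the expected demand at
  price \<open>p\<close>.  The function \<open>E\<close> is convex with subgradient \<open>- T p\<close> at \<open>p\<close>; as \<open>T\<close> is continuous,
  \<open>E\<close> is differentiable with derivative \<open>- T\<close>
  (\<open>expected_demand_has_derivative\<close>).  Hence the revenue \<open>R p = p * E p\<close> has derivative
  \<open>E p - p * T p\<close>.  Since the mean residual demand at \<open>0 \<le> p < H\<close> is \<open>E p / T p\<close>
  (\<open>mrd_eq_expected_demand\<close>), the sign of \<open>R' p\<close> for \<open>0 < p < H\<close> is the sign of \<open>\<ell> p - 1\<close>, and
  the elasticity is \<open>p * T p / E p = 1 / \<ell> p\<close>.

  If \<open>p\<^sub>1 < \<infinity>\<close>, then \<open>R' \<le> 0\<close> at positive prices beyond \<open>p\<^sub>1\<close>, so the maximum of \<open>R\<close>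
  over a compact interval from \<open>0\<close> to a price not below \<open>p\<^sub>1\<close> is a maximum over all prices.
  At prices \<open>p \<ge> 0\<close> the revenue is positive exactly for \<open>0 < p < H\<close>, so a maximizer lies in this
  open set, where \<open>R' p = 0\<close>, that is \<open>\<ell> p = 1\<close>.  If \<open>\<ell>\<close> is strictly decreasing, the equation
  \<open>\<ell> p = 1\<close> has at most one solution, and so the maximizer is its only solution.
\<close>

section \<open>The distribution of the demand level\<close>

text \<open>
  A random demand level with finite mean and continuous distribution function \<open>F\<close>, where
  \<open>F 0 = 0\<close> makes it almost surely positive.
\<close>

locale random_demand = prob_space M for M :: "'a measure" +
  fixes \<alpha> :: "'a \<Rightarrow> real"
  assumes measurable_level [measurable]: "\<alpha> \<in> borel_measurable M"
    and continuous_distr: "continuous_on UNIV (distr_fun M \<alpha>)"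
    and distr_zero: "distr_fun M \<alpha> 0 = 0"
    and integrable_level: "integrable M \<alpha>"
begin

text \<open>The survival function of the demand level.\<close>

definition tail :: "real \<Rightarrow> real" where
  "tail p = prob {\<omega> \<in> space M. \<alpha> \<omega> > p}"

lemma tail_eq: "tail p = 1 - distr_fun M \<alpha> p"
proof -
  have "distr_fun M \<alpha> p = prob {\<omega> \<in> space M. \<alpha> \<omega> \<le> p}"
    unfolding distr_fun_def cdf_def
    by (subst measure_distr) (auto intro!: arg_cong[where f="measure M"])
  moreover have "prob {\<omega> \<in> space M. \<not> \<alpha> \<omega> \<le> p} = 1 - prob {\<omega> \<in> space M. \<alpha> \<omega> \<le> p}"
    by (rule prob_neg) measurable
  ultimately show ?thesis by (simp add: tail_def not_le)
qed

lemma tail_nonneg: "0 \<le> tail p"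
  by (simp add: tail_def)

lemma tail_antimono: "p \<le> q \<Longrightarrow> tail q \<le> tail p"
  unfolding tail_def by (intro finite_measure_mono) auto

lemma tail_zero: "tail 0 = 1"
  by (simp add: tail_eq distr_zero)

lemma isCont_tail: "isCont tail p"
proof -
  have "continuous_on UNIV tail"
    unfolding tail_eq[abs_def] by (intro continuous_intros continuous_distr)
  then show ?thesis by (simp add: continuous_on_eq_continuous_at)
qed

text \<open>
  The infimum defining \<open>H\<close> is attained when it is finite, because \<open>F\<close> is continuous.
\<close>

lemma tail_pos_iff:
  assumes "0 \<le> p"
  shows "0 < tail p \<longleftrightarrow> ereal p < upper_end M \<alpha>"
proof
  assume "ereal p < upper_end M \<alpha>"
  have "tail p \<noteq> 0"
  proof
    assume "tail p = 0"
    then have "upper_end M \<alpha> \<le> ereal p"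
      unfolding upper_end_def using assms by (intro INF_lower) (auto simp: tail_eq)
    with \<open>ereal p < upper_end M \<alpha>\<close> show False by simp
  qed
  then show "0 < tail p" using tail_nonneg[of p] by simp
next
  assume pos: "0 < tail p"
  show "ereal p < upper_end M \<alpha>"
  proof (rule ccontr)
    assume le: "\<not> ereal p < upper_end M \<alpha>"
    have "tail r = 0" if "p < r" for r
    proof -
      have "upper_end M \<alpha> < ereal r"
        using le that by (simp add: not_less order_le_less_trans)
      then obtain s where "distr_fun M \<alpha> s = 1" "s < r"
        unfolding upper_end_def by (auto simp: INF_less_iff)
      then show ?thesis
        using tail_antimono[of s r] tail_nonneg[of r] by (simp add: tail_eq[of s])
    qed
    then have "eventually (\<lambda>r. tail r = 0) (at_right p)"
      by (auto intro: eventually_at_right_less eventually_mono)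
    then have "(tail \<longlongrightarrow> 0) (at_right p)"
      by (rule tendsto_eventually)
    moreover have "(tail \<longlongrightarrow> tail p) (at_right p)"
      using isCont_tail[of p] unfolding isCont_def
        by (rule filterlim_at_split[THEN iffD1, THEN conjunct2])
    ultimately have "tail p = 0"
      using tendsto_unique trivial_limit_at_right_real by blast
    then show False using pos by simp
  qed
qed

section \<open>Expected demand and mean residual demand\<close>

lemma integrable_demand: "integrable M (\<lambda>\<omega>. demand p (\<alpha> \<omega>))"
  unfolding demand_def using integrable_level by (intro integrable_max) auto

lemma expected_demand_nonneg: "0 \<le> expected_demand M \<alpha> p"
  unfolding expected_demand_def demand_def by (intro Bochner_Integration.integral_nonneg) auto

lemma expected_demand_eq_0_iff: "expected_demand M \<alpha> p = 0 \<longleftrightarrow> tail p = 0"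
proof -
  have "expected_demand M \<alpha> p = 0 \<longleftrightarrow> (AE \<omega> in M. demand p (\<alpha> \<omega>) = 0)"
    unfolding expected_demand_def
    by (rule integral_nonneg_eq_0_iff_AE[OF integrable_demand]) (simp add: demand_def)
  also have "\<dots> \<longleftrightarrow> (AE \<omega> in M. \<not> \<alpha> \<omega> > p)"
    by (intro arg_cong[where f="\<lambda>P. almost_everywhere M P"] ext) (auto simp: demand_def max_def)
  also have "\<dots> \<longleftrightarrow> tail p = 0"
    unfolding tail_def by (subst prob_eq_0) auto
  finally show ?thesis .
qed

lemma expected_demand_pos_iff: "0 < expected_demand M \<alpha> p \<longleftrightarrow> 0 < tail p"
  using expected_demand_eq_0_iff[of p] expected_demand_nonneg[of p] tail_nonneg[of p] by auto

lemma mrd_eq_expected_demand: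
  assumes "0 \<le> p" and p: "ereal p < upper_end M \<alpha>"
  shows "mrd M \<alpha> p = expected_demand M \<alpha> p / tail p"
proof -
  let ?A = "{\<omega> \<in> space M. \<alpha> \<omega> > p}"
  have pos: "0 < prob ?A"
    using assms tail_pos_iff by (simp add: tail_def)
  have density: "uniform_measure M ?A = density M (\<lambda>\<omega>. ennreal (indicator ?A \<omega> / prob ?A))"
    unfolding uniform_measure_def using pos
    by (intro arg_cong[where f="density M"])
       (auto simp: fun_eq_iff emeasure_eq_measure divide_ennreal
             simp flip: ennreal_1 split: split_indicator)
  have "mrd M \<alpha> p = (LINT \<omega>|M. (indicator ?A \<omega> / prob ?A) *\<^sub>R (\<alpha> \<omega> - p))"
    unfolding mrd_def density using p pos by (simp, subst integral_density) auto
  also have "\<dots> = (LINT \<omega>|M. demand p (\<alpha> \<omega>) / prob ?A)"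
    by (intro Bochner_Integration.integral_cong) (auto simp: demand_def split: split_indicator)
  finally show ?thesis
    by (simp add: expected_demand_def tail_def)
qed

text \<open>The convex function \<open>expected_demand M \<alpha>\<close> has subgradient \<open>- tail p\<close> at \<open>p\<close>.\<close>

lemma expected_demand_subgradient:
  "expected_demand M \<alpha> p - (q - p) * tail p \<le> expected_demand M \<alpha> q"
proof -
  let ?A = "{\<omega> \<in> space M. \<alpha> \<omega> > p}"
  have int: "integrable M (\<lambda>\<omega>. (q - p) * indicat_real ?A \<omega>)"
    by (intro integrable_mult_right integrable_real_indicator) (auto simp: emeasure_eq_measure)
  have "expected_demand M \<alpha> p - (q - p) * tail p
      = (LINT \<omega>|M. demand p (\<alpha> \<omega>) - (q - p) * indicat_real ?A \<omega>)"
    unfolding expected_demand_def tail_def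
    by (subst Bochner_Integration.integral_diff[OF integrable_demand int])
       (simp add: Int_absorb1)
  also have "\<dots> \<le> expected_demand M \<alpha> q"
    unfolding expected_demand_def
    by (intro integral_mono Bochner_Integration.integrable_diff integrable_demand int)
       (auto simp: demand_def split: split_indicator)
  finally show ?thesis .
qed

lemma expected_demand_has_derivative:
  "(expected_demand M \<alpha> has_real_derivative - tail p) (at p)"
proof -
  let ?E = "expected_demand M \<alpha>"
  let ?D = "\<lambda>q. (?E q - ?E p) / (q - p)"
  have "\<bar>?D q - (- tail p)\<bar> \<le> \<bar>tail q - tail p\<bar>" if "q \<noteq> p" for q
  proof -
    \<comment> \<open>The subgradient inequalities at \<open>p\<close> and at \<open>q\<close> bound the same quantity on both sides.\<close>
    have "0 \<le> ?E q - ?E p + (q - p) * tail p"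
      using expected_demand_subgradient[of p q] by (simp add: algebra_simps)
    moreover have "?E q - ?E p + (q - p) * tail p \<le> (q - p) * (tail p - tail q)"
      using expected_demand_subgradient[of q p] by (simp add: algebra_simps)
    ultimately have "\<bar>?E q - ?E p + (q - p) * tail p\<bar> \<le> \<bar>(q - p) * (tail p - tail q)\<bar>"
      by linarith
    then have "\<bar>?E q - ?E p + (q - p) * tail p\<bar> \<le> \<bar>tail q - tail p\<bar> * \<bar>q - p\<bar>"
      by (simp add: abs_mult mult.commute abs_minus_commute)
    moreover have "?D q - (- tail p) = (?E q - ?E p + (q - p) * tail p) / (q - p)"
      using that by (simp add: field_simps)
    ultimately show ?thesis
      using that by (simp add: pos_divide_le_eq)
  qed
  then have "eventually (\<lambda>q. norm (?D q - (- tail p)) \<le> \<bar>tail q - tail p\<bar>) (at p)"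
    by (auto simp: eventually_at intro!: exI[of _ 1])
  moreover have "((\<lambda>q. \<bar>tail q - tail p\<bar>) \<longlongrightarrow> 0) (at p)"
    using isCont_tail[of p] unfolding isCont_def
    by (intro tendsto_rabs_zero) (simp add: LIM_zero)
  ultimately have "((\<lambda>q. ?D q - (- tail p)) \<longlongrightarrow> 0) (at p)"
    by (rule Lim_null_comparison)
  then have "(?D \<longlongrightarrow> - tail p) (at p)"
    by (rule LIM_zero_cancel)
  then show ?thesis
    by (simp add: has_field_derivative_iff)
qed

section \<open>Unit elasticity and fixed points\<close>

lemma gmrd_dom_iff: "p \<in> gmrd_dom M \<alpha> \<longleftrightarrow> 0 < p \<and> 0 < tail p"
  unfolding gmrd_dom_def using tail_pos_iff[of p] by auto

lemma gmrd_eq: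
  assumes "p \<in> gmrd_dom M \<alpha>"
  shows "gmrd M \<alpha> p = expected_demand M \<alpha> p / (p * tail p)"
  using assms mrd_eq_expected_demand[of p] by (simp add: gmrd_def gmrd_dom_def mult.commute)

lemma gmrd_eq_1_iff:
  assumes "p \<in> gmrd_dom M \<alpha>"
  shows "gmrd M \<alpha> p = 1 \<longleftrightarrow> expected_demand M \<alpha> p = p * tail p"
  using assms gmrd_eq[OF assms] by (auto simp: gmrd_dom_iff)

lemma elasticity_eq: "elasticity M \<alpha> p = p * tail p / expected_demand M \<alpha> p"
  by (simp add: elasticity_def DERIV_imp_deriv[OF expected_demand_has_derivative])

lemma elasticity_eq_1_iff:
  assumes "p \<in> gmrd_dom M \<alpha>"
  shows "elasticity M \<alpha> p = 1 \<longleftrightarrow> gmrd M \<alpha> p = 1"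
proof -
  have "0 < expected_demand M \<alpha> p"
    using assms by (simp add: gmrd_dom_iff expected_demand_pos_iff)
  then show ?thesis
    unfolding elasticity_eq gmrd_eq_1_iff[OF assms] by auto
qed

text \<open>
  A fixed point needs no restriction to the domain of the generalized mean residual demand: the
  mean residual demand at \<open>0\<close> is the positive mean demand level, and it vanishes from \<open>H > 0\<close> on.
\<close>

lemma mrd_fixed_point_iff:
  assumes "0 \<le> p"
  shows "p = mrd M \<alpha> p \<longleftrightarrow> p \<in> gmrd_dom M \<alpha> \<and> gmrd M \<alpha> p = 1"
proof (cases "p = 0")
  case True
  have "0 < expected_demand M \<alpha> 0 / tail 0"
    by (simp add: tail_zero expected_demand_pos_iff)
  moreover have "mrd M \<alpha> 0 = expected_demand M \<alpha> 0 / tail 0"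
    using tail_pos_iff[of 0] by (intro mrd_eq_expected_demand) (auto simp: tail_zero)
  ultimately show ?thesis
    using True unfolding gmrd_dom_def by force
next
  case False
  show ?thesis
    using False assms by (auto simp: gmrd_def gmrd_dom_def mrd_def)
qed

section \<open>Maximal revenue\<close>

lemma revenue_has_derivative:
  "(revenue M \<alpha> has_real_derivative expected_demand M \<alpha> p - p * tail p) (at p)"
  unfolding revenue_def[abs_def]
  by (auto intro!: derivative_eq_intros expected_demand_has_derivative)

lemma revenue_pos_iff:
  assumes "0 \<le> p"
  shows "0 < revenue M \<alpha> p \<longleftrightarrow> p \<in> gmrd_dom M \<alpha>"
  using assms expected_demand_pos_iff[of p] expected_demand_nonneg[of p]
  by (auto simp: revenue_def gmrd_dom_iff zero_less_mult_iff)

lemma gmrd_dom_nonempty: "gmrd_dom M \<alpha> \<noteq> {}"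
proof -
  have "(tail \<longlongrightarrow> tail 0) (at_right 0)"
    using isCont_tail[of 0] unfolding isCont_def
        by (rule filterlim_at_split[THEN iffD1, THEN conjunct2])
  then have "eventually (\<lambda>p. 0 < tail p) (at_right 0)"
    by (rule order_tendstoD) (simp add: tail_zero)
  moreover have "eventually (\<lambda>p. 0 < p) (at_right (0::real))"
    by (rule eventually_at_right_less)
  ultimately have "eventually (\<lambda>p. p \<in> gmrd_dom M \<alpha>) (at_right 0)"
    by eventually_elim (simp add: gmrd_dom_iff)
  from eventually_happens'[OF trivial_limit_at_right_real this] show ?thesis by blast
qed

lemma revenue_max_imp:
  assumes "is_arg_max (revenue M \<alpha>) (\<lambda>p. 0 \<le> p) p"
  shows "p \<in> gmrd_dom M \<alpha> \<and> gmrd M \<alpha> p = 1"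
proof
  have "0 \<le> p" using assms by (simp add: is_arg_max_def)
  have max: "revenue M \<alpha> q \<le> revenue M \<alpha> p" if "0 \<le> q" for q
    using assms that by (simp add: is_arg_max_linorder)
  obtain r where r: "r \<in> gmrd_dom M \<alpha>" using gmrd_dom_nonempty by blast
  then have "0 \<le> r" by (simp add: gmrd_dom_iff)
  then have "0 < revenue M \<alpha> r" using r revenue_pos_iff by simp
  then have "0 < revenue M \<alpha> p" using max[OF \<open>0 \<le> r\<close>] by linarith
  then show dom: "p \<in> gmrd_dom M \<alpha>" using \<open>0 \<le> p\<close> revenue_pos_iff by simp
  then have "0 < p" by (simp add: gmrd_dom_iff)
  have "expected_demand M \<alpha> p - p * tail p = 0"
  proof (rule DERIV_local_max[OF revenue_has_derivative \<open>0 < p\<close>], intro allI impI)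
    fix q assume "\<bar>p - q\<bar> < p"
    then show "revenue M \<alpha> q \<le> revenue M \<alpha> p" by (intro max) auto
  qed
  then show "gmrd M \<alpha> p = 1" using gmrd_eq_1_iff[OF dom] by simp
qed

lemma revenue_max_exists:
  assumes "p_one M \<alpha> < \<infinity>"
  shows "\<exists>p. is_arg_max (revenue M \<alpha>) (\<lambda>p. 0 \<le> p) p"
proof -
  obtain b where "0 \<le> b" and b: "p_one M \<alpha> \<le> ereal b"
  proof (cases "p_one M \<alpha>")
    case (real r)
    then show ?thesis using that[of "max r 0"] by simp
  next
    case MInf
    then show ?thesis using that[of 0] by simp
  qed (use assms in simp)
  \<comment> \<open>At prices from \<open>H\<close> on, where \<open>tail p = 0\<close>, the derivative of the revenue is \<open>0\<close>.\<close>
  have nonincreasing: "expected_demand M \<alpha> p - p * tail p \<le> 0" if "b < p" for p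
  proof (cases "0 < tail p")
    case True
    then have dom: "p \<in> gmrd_dom M \<alpha>" using that \<open>0 \<le> b\<close> by (simp add: gmrd_dom_iff)
    have "\<not> 1 \<le> gmrd M \<alpha> p"
    proof
      assume "1 \<le> gmrd M \<alpha> p"
      then have "ereal p \<le> p_one M \<alpha>"
        unfolding p_one_def using dom by (intro SUP_upper) auto
      also have "\<dots> \<le> ereal b" by (rule b)
      finally show False using that by simp
    qed
    then show ?thesis
      using dom by (simp add: gmrd_eq gmrd_dom_iff field_simps)
  next
    case False
    then have "tail p = 0" using tail_nonneg[of p] by simp
    then show ?thesis using expected_demand_eq_0_iff[of p] by simp
  qed
  have cont: "continuous_on S (revenue M \<alpha>)" for S
    using DERIV_isCont[OF revenue_has_derivative]
    by (intro continuous_at_imp_continuous_on) blast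
  obtain p where p: "p \<in> {0..b}" and max: "\<forall>q\<in>{0..b}. revenue M \<alpha> q \<le> revenue M \<alpha> p"
    using continuous_attains_sup[of "{0..b}" "revenue M \<alpha>"] cont \<open>0 \<le> b\<close> by auto
  have "revenue M \<alpha> q \<le> revenue M \<alpha> p" if "0 \<le> q" for q
  proof (cases "q \<le> b")
    case True
    then show ?thesis using max that by simp
  next
    case False
    then have "revenue M \<alpha> q \<le> revenue M \<alpha> b"
    proof (intro DERIV_nonpos_imp_decreasing_open[of b q] cont)
      fix x assume "b < x"
      then show "\<exists>y. (revenue M \<alpha> has_real_derivative y) (at x) \<and> y \<le> 0"
        using nonincreasing revenue_has_derivative by blast
    qed simp
    also have "\<dots> \<le> revenue M \<alpha> p" using max \<open>0 \<le> b\<close> by simp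
    finally show ?thesis .
  qed
  then show ?thesis using p by (auto simp: is_arg_max_linorder)
qed

end

theorem theorem2p3:
  fixes M :: "'a measure" and \<alpha> :: "'a \<Rightarrow> real"
  assumes "prob_space M"
    and "\<alpha> \<in> borel_measurable M"
    and "AE \<omega> in M. 0 \<le> \<alpha> \<omega>"
    and "continuous_on UNIV (distr_fun M \<alpha>)"
    and "distr_fun M \<alpha> 0 = 0"
    and "integrable M \<alpha>"
    and "p_one M \<alpha> < \<infinity>"
  shows
    "(\<exists>p. is_arg_max (revenue M \<alpha>) (\<lambda>p. 0 \<le> p) p)
     \<and> (\<forall>p. is_arg_max (revenue M \<alpha>) (\<lambda>p. 0 \<le> p) p \<longrightarrow>
          p \<in> gmrd_dom M \<alpha> \<and> elasticity M \<alpha> p = 1 \<and> gmrd M \<alpha> p = 1 \<and> p = mrd M \<alpha> p)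
     \<and> (\<forall>p\<ge>0.
          (p \<in> gmrd_dom M \<alpha> \<and> elasticity M \<alpha> p = 1 \<longleftrightarrow> p \<in> gmrd_dom M \<alpha> \<and> gmrd M \<alpha> p = 1)
          \<and> (p \<in> gmrd_dom M \<alpha> \<and> gmrd M \<alpha> p = 1 \<longleftrightarrow> p = mrd M \<alpha> p))
     \<and> (strict_antimono_on (gmrd_dom M \<alpha>) (gmrd M \<alpha>) \<longrightarrow>
          (\<exists>!p. 0 \<le> p \<and> p = mrd M \<alpha> p)
          \<and> (\<forall>p\<ge>0. p = mrd M \<alpha> p \<longrightarrow> is_arg_max (revenue M \<alpha>) (\<lambda>p. 0 \<le> p) p))"
proof -
  interpret random_demand M \<alpha>
    using assms by (intro random_demand.intro random_demand_axioms.intro)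
  let ?max = "is_arg_max (revenue M \<alpha>) (\<lambda>p. 0 \<le> p)"
  have equivalences: "(p \<in> gmrd_dom M \<alpha> \<and> elasticity M \<alpha> p = 1
        \<longleftrightarrow> p \<in> gmrd_dom M \<alpha> \<and> gmrd M \<alpha> p = 1)
      \<and> (p \<in> gmrd_dom M \<alpha> \<and> gmrd M \<alpha> p = 1 \<longleftrightarrow> p = mrd M \<alpha> p)" if "0 \<le> p" for p
    using elasticity_eq_1_iff[of p] mrd_fixed_point_iff[OF that] by blast
  have necessary: "p \<in> gmrd_dom M \<alpha> \<and> elasticity M \<alpha> p = 1 \<and> gmrd M \<alpha> p = 1 \<and> p = mrd M \<alpha> p"
    if "?max p" for p
  proof -
    have "0 \<le> p" using that by (simp add: is_arg_max_def)
    then show ?thesis using revenue_max_imp[OF that] equivalences[of p] by blast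
  qed
  obtain m where m: "?max m" using revenue_max_exists assms(7) by blast
  then have "0 \<le> m" by (simp add: is_arg_max_def)
  have unique: "p = m"
    if anti: "strict_antimono_on (gmrd_dom M \<alpha>) (gmrd M \<alpha>)" and p: "0 \<le> p" "p = mrd M \<alpha> p" for p
  proof -
    have "p \<in> gmrd_dom M \<alpha>" "gmrd M \<alpha> p = 1"
      using equivalences[of p] p by blast+
    moreover have "m \<in> gmrd_dom M \<alpha>" "gmrd M \<alpha> m = 1"
      using necessary[OF m] by blast+
    ultimately show "p = m"
      using monotone_onD[OF anti, of p m] monotone_onD[OF anti, of m p]
      by (cases p m rule: linorder_cases) auto
  qed
  have "\<exists>!p. 0 \<le> p \<and> p = mrd M \<alpha> p"
    if "strict_antimono_on (gmrd_dom M \<alpha>) (gmrd M \<alpha>)"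
    using \<open>0 \<le> m\<close> necessary[OF m] unique[OF that] by blast
  moreover have "?max p"
    if "strict_antimono_on (gmrd_dom M \<alpha>) (gmrd M \<alpha>)" "0 \<le> p" "p = mrd M \<alpha> p" for p
    using unique[OF that] m by simp
  ultimately show ?thesis
    using m necessary equivalences by blast
qed

end
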